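(* Let $\alpha>0$, $t>0$ and let $\beta_n=\beta_n(t)$ be the recurrence coefficients of the monic orthogonal polynomials for the weight $w(x,t)=(1-x^2)^\alpha e^{-t/(1-x^2)}$ on $[-1,1]$. For every integer $n\ge 1$, put $$\tilde\beta_{n-1}:=(2n-3+2\alpha)\beta_{n-1}(t),\qquad \tilde\beta_{n+1}:=(2n+3+2\alpha)\beta_{n+1}(t).$$ Then $\beta_n$ satisfies the second-order nonlinear difference equation $$\begin{aligned} &\Big\{\left[68(n+\alpha)^2-9\right]\beta_n^3+\big[12-80(n+\alpha)^2+(14n+5+14\alpha)\tilde\beta_{n-1}+(14n-5+14\alpha)\tilde\beta_{n+1}\big]\beta_n^2\\ &\quad+\big[24(n+\alpha)^2+4t(t-2\alpha)-3-2(2n+1+2\alpha)\tilde\beta_{n-1}-2(2n-1+2\alpha)\tilde\beta_{n+1}+\tilde\beta_{n-1}\tilde\beta_{n+1}\big]\beta_n\\ &\quad-2\left[(n+\alpha)^2-t\alpha\right]\Big\}^2\\ &=4\Big\{2(2n-1+2\alpha)(2n+1+2\alpha)\beta_n^2+\big[(2n+1+2\alpha)\tilde\beta_{n-1}+(2n-1+2\alpha)\tilde\beta_{n+1}\\ &\quad-2(2n-1+2\alpha)(2n+1+2\alpha)\big]\beta_n+(n+\alpha)^2+t(t-2\alpha)\Big\}\\ &\quad\times\Big\{12(n+\alpha)\beta_n^2+\big[\tilde\beta_{n-1}+\tilde\beta_{n+1}-8(n+\alpha)\big]\beta_n+n+\alpha\Big\}^2 . \end{aligned}$$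
   Context: Fix $\alpha>0$, $t>0$ and $w(x,t):=(1-x^2)^\alpha e^{-t/(1-x^2)}$, $x\in[-1,1]$. Let $P_n(x,t)$, $n=0,1,2,\ldots$, be the monic polynomials of degree $n$ with $\int_{-1}^1 P_mP_n w\,dx=h_n(t)\delta_{mn}$. Since $w$ is even, they satisfy $xP_n(x,t)=P_{n+1}(x,t)+\beta_n(t)P_{n-1}(x,t)$ with $P_0=1$, $P_{-1}=0$, where $\beta_n(t)=h_n(t)/h_{n-1}(t)$ for $n\ge1$ and $\beta_0(t)=0$. *)

theory Defs
  imports "HOL-Analysis.Analysis" "HOL-Computational_Algebra.Polynomial"
begin

text \<open>At the endpoints \<open>x = \<plusminus>1\<close> we have \<open>t / 0 = 0\<close> and \<open>0 powr \<alpha> = 0\<close>, so the weight takes its limiting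
  value \<open>0\<close> there.\<close>

definition weight :: "real \<Rightarrow> real \<Rightarrow> real \<Rightarrow> real" where
  "weight \<alpha> t x = (1 - x\<^sup>2) powr \<alpha> * exp (- t / (1 - x\<^sup>2))"

definition monic_orthogonal :: "(real \<Rightarrow> real) \<Rightarrow> (nat \<Rightarrow> real poly) \<Rightarrow> (nat \<Rightarrow> real) \<Rightarrow> bool" where
  "monic_orthogonal w P h \<longleftrightarrow>
     (\<forall>n. degree (P n) = n \<and> lead_coeff (P n) = 1) \<and>
     (\<forall>m n. integral {-1..1} (\<lambda>x. poly (P m) x * poly (P n) x * w x) = (if m = n then h n else 0))"

definition recurrence_coeff :: "(nat \<Rightarrow> real) \<Rightarrow> nat \<Rightarrow> real" where
  "recurrence_coeff h n = (if n = 0 then 0 else h n / h (n - 1))"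

text \<open>The weight is continuous on the closed interval, so the integrals above are ordinary ones and the
  numbers \<open>recurrence_coeff h n\<close> are indeed the coefficients of the three-term recurrence.\<close>

lemma continuous_on_weight:
  assumes "\<alpha> > 0" "t > 0"
  shows "continuous_on {-1..1} (weight \<alpha> t)"
  unfolding continuous_on_def
proof
  fix x :: real assume x: "x \<in> {-1..1}"
  show "(weight \<alpha> t \<longlongrightarrow> weight \<alpha> t x) (at x within {-1..1})"
  proof (cases "1 - x\<^sup>2 = 0")
    case True
    have 1: "((\<lambda>y. (1 - y\<^sup>2) powr \<alpha>) \<longlongrightarrow> (1 - x\<^sup>2) powr \<alpha>) (at x within {-1..1})"
    proof (rule tendsto_powr')
      show "((\<lambda>y. 1 - y\<^sup>2) \<longlongrightarrow> 1 - x\<^sup>2) (at x within {-1..1})" by (intro tendsto_intros)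
      show "1 - x\<^sup>2 \<noteq> 0 \<or> 0 < \<alpha> \<and> (\<forall>\<^sub>F y in at x within {-1..1}. 0 \<le> 1 - y\<^sup>2)"
        using assms by (auto simp: eventually_at_filter abs_square_le_1 abs_le_iff
          intro!: always_eventually)
    qed (intro tendsto_intros)
    have "(weight \<alpha> t \<longlongrightarrow> 0) (at x within {-1..1})"
    proof (rule Lim_null_comparison)
      show "\<forall>\<^sub>F y in at x within {-1..1}. norm (weight \<alpha> t y) \<le> (1 - y\<^sup>2) powr \<alpha>"
        unfolding eventually_at_filter
      proof (intro always_eventually allI impI)
        fix y :: real assume "y \<in> {-1..1}"
        then have "1 - y\<^sup>2 \<ge> 0" by (simp add: abs_square_le_1 abs_le_iff)
        then have "exp (- t / (1 - y\<^sup>2)) \<le> 1" using assms by simp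
        then show "norm (weight \<alpha> t y) \<le> (1 - y\<^sup>2) powr \<alpha>"
          unfolding weight_def by (simp add: abs_mult mult_left_le)
      qed
      show "((\<lambda>y. (1 - y\<^sup>2) powr \<alpha>) \<longlongrightarrow> 0) (at x within {-1..1})" using 1 True by simp
    qed
    moreover have "weight \<alpha> t x = 0" unfolding weight_def True by simp
    ultimately show ?thesis by simp
  next
    case False
    then show ?thesis unfolding weight_def by (intro tendsto_intros) auto
  qed
qed

lemma weight_minus: "weight \<alpha> t (- x) = weight \<alpha> t x"
  by (simp add: weight_def)

lemma three_term_recurrence:
  assumes at: "\<alpha> > 0" "t > 0" and mo: "monic_orthogonal (weight \<alpha> t) P h"
  shows "[:0, 1:] * P n =
    P (Suc n) + smult (recurrence_coeff h n) (if n = 0 then 0 else P (n - 1))"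
proof -
  let ?w = "weight \<alpha> t"
  define ip where "ip p q = integral {-1..1} (\<lambda>x. poly p x * poly q x * ?w x)" for p q
  have deg: "degree (P k) = k" and lc: "coeff (P k) k = 1" for k
    using mo unfolding monic_orthogonal_def by metis+
  have orth: "ip (P m) (P k) = (if m = k then h k else 0)" for m k
    using mo unfolding monic_orthogonal_def ip_def by metis
  have cont: "continuous_on {-1..1} (\<lambda>x. poly p x * poly q x * ?w x)" for p q
    by (intro continuous_intros continuous_on_weight at)
  have int: "(\<lambda>x. poly p x * poly q x * ?w x) integrable_on {-1..1}" for p q
    by (rule integrable_continuous_real[OF cont])
  have ip_add: "ip p (q + r) = ip p q + ip p r" for p q r
    unfolding ip_def integral_add[OF int int, symmetric] by (simp add: algebra_simps)
  have ip_smult: "ip p (smult c q) = c * ip p q" for p q c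
    unfolding ip_def integral_mult_right[symmetric] by (simp add: mult_ac)
  have ip_comm: "ip p q = ip q p" for p q unfolding ip_def by (simp add: mult_ac)
  have ip_diff: "ip p (q - r) = ip p q - ip p r" for p q r
    using ip_add[of p q "smult (-1) r"] ip_smult[of p "-1" r] by simp
  have ip_x: "ip ([:0,1:] * p) q = ip p ([:0,1:] * q)" for p q
    unfolding ip_def by (simp add: mult_ac)
  have ip_pos: "p = 0" if "ip p p = 0" for p
  proof (rule ccontr)
    assume "p \<noteq> 0"
    have "\<forall>x\<in>{-1..1}. poly p x * poly p x * ?w x = 0"
      using that integral_eq_0_iff[OF cont, of p p] unfolding ip_def by (auto simp: weight_def)
    then have "{0<..<1} \<subseteq> {x. poly p x = 0}"
      by (force simp: weight_def abs_square_eq_1 power2_eq_1_iff)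
    then have "finite {0<..<1::real}"
      using \<open>p \<noteq> 0\<close> poly_roots_finite finite_subset by blast
    then show False by (simp add: infinite_Ioo)
  qed
  have span: "ip p q = 0" if "\<And>k. k \<le> d \<Longrightarrow> ip p (P k) = 0" "degree q \<le> d" for p q d
    using that
  proof (induction d arbitrary: q)
    case 0
    have "degree (q - smult (coeff q 0) (P 0)) = 0"
      using 0 deg[of 0] degree_diff_le[of q 0 "smult (coeff q 0) (P 0)"] by simp
    moreover have "coeff (q - smult (coeff q 0) (P 0)) 0 = 0" using lc[of 0] by simp
    ultimately have "q - smult (coeff q 0) (P 0) = 0"
      by (metis leading_coeff_0_iff)
    then have "q = smult (coeff q 0) (P 0)" by simp
    then show ?case using 0(1)[of 0] ip_smult by (metis le_refl mult_zero_right)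
  next
    case (Suc d)
    define r where "r = q - smult (coeff q (Suc d)) (P (Suc d))"
    have "degree r \<le> Suc d" unfolding r_def
      by (rule degree_diff_le[OF Suc.prems(2)]) (use deg degree_smult_le in metis)
    moreover have "coeff r (Suc d) = 0" unfolding r_def using lc by simp
    ultimately have "degree r \<le> d"
      by (metis le_SucE coeff_0 leading_coeff_0_iff degree_0 le0)
    then have "ip p r = 0" using Suc by simp
    then show ?case using Suc.prems(1)[of "Suc d"] unfolding r_def ip_diff ip_smult by simp
  qed
  have low: "ip (P k) q = 0" if "degree q < k" for k q
  proof (cases k)
    case (Suc d)
    show ?thesis by (rule span[of d]) (use that Suc orth in auto)
  qed (use that in simp)
  have hne: "h k \<noteq> 0" for k
    using ip_pos[of "P k"] orth[of k k] lc[of k] by auto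
  define R where "R p = pcompose p [:0, -1:]" for p :: "real poly"
  have R: "poly (R p) x = poly p (- x)" for p x by (simp add: R_def poly_pcompose)
  have dR: "degree (R p) = degree p" for p by (simp add: R_def degree_pcompose)
  have ipR: "ip (R p) q = ip p (R q)" for p q
  proof -
    have "ip p (R q) = integral {-1..1} (\<lambda>x. poly p (- x) * poly (R q) (- x) * ?w (- x))"
      unfolding ip_def
      using Henstock_Kurzweil_Integration.integral_reflect_real[of 1 "-1" "\<lambda>x. poly p x * poly (R q) x * ?w x"]
      by (simp del: Henstock_Kurzweil_Integration.integral_reflect_real)
    then show ?thesis unfolding ip_def by (simp add: R weight_minus)
  qed
  have par: "R (P k) = smult ((-1) ^ k) (P k)" for k
  proof -
    define D where "D = R (P k) - smult ((-1) ^ k) (P k)"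
    have lcR: "coeff (R (P k)) k = (-1) ^ k"
      using lead_coeff_comp[of "[:0, -1:] :: real poly" "P k"] dR[of "P k"] deg[of k] lc[of k]
      unfolding R_def by simp
    have 1: "ip D q = 0" if "degree q < k" for q
      using low[OF that] low[of "R q" k] that dR ipR[of "P k" q]
      unfolding D_def by (subst ip_comm) (simp add: ip_diff ip_smult ip_comm)
    have "D = 0 \<or> degree D < k"
    proof -
      have "degree D \<le> k" unfolding D_def
        by (rule degree_diff_le) (simp_all add: dR deg)
      moreover have "coeff D k = 0" unfolding D_def using lcR lc by simp
      ultimately show ?thesis by (metis le_neq_implies_less leading_coeff_0_iff)
    qed
    then have "D = 0" using 1[of D] ip_pos by blast
    then show ?thesis unfolding D_def by simp
  qed
  have mid: "ip ([:0,1:] * P n) (P n) = 0"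
  proof -
    have "poly (P n) (- x) * poly (P n) (- x) = poly (P n) x * poly (P n) x" for x
    proof -
      have "poly (P n) (- x) = (-1) ^ n * poly (P n) x" using R[of "P n" x] par[of n] by simp
      moreover have "(-1) ^ n * (-1) ^ n = (1::real)" by (simp flip: power_mult_distrib)
      ultimately show ?thesis by (simp add: algebra_simps)
    qed
    note sq = this
    define g where "g x = poly ([:0,1:] * P n) x * poly (P n) x * ?w x" for x
    have odd: "g (- x) = - g x" for x
      using sq[of x] by (simp add: g_def weight_minus mult.assoc)
    have "integral {-1..1} (\<lambda>x. g (- x)) = integral {-1..1} g"
      using Henstock_Kurzweil_Integration.integral_reflect_real[of 1 "-1" g]
      by (simp del: Henstock_Kurzweil_Integration.integral_reflect_real)
    then have "integral {-1..1} g = 0" unfolding odd by simp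
    then show ?thesis unfolding ip_def g_def .
  qed
  have dx: "degree ([:0,1:] * P k) = Suc k" for k
    using deg[of k] lc[of k] by (auto simp: degree_pCons_eq_if)
  have lx: "coeff ([:0,1:] * P k) (Suc k) = 1" for k using lc by simp
  define L where "L = (if n = 0 then 0 else P (n - 1))"
  define b where "b = recurrence_coeff h n"
  define r where "r = [:0,1:] * P n - P (Suc n) - smult b L"
  have dL: "degree L \<le> n" unfolding L_def using deg by simp
  have dr: "degree r \<le> n"
  proof -
    have "degree r \<le> Suc n" unfolding r_def
      using dx[of n] deg[of "Suc n"] dL degree_smult_le[of b L]
      by (intro degree_diff_le) auto
    moreover have "coeff L (Suc n) = 0" using dL by (intro coeff_eq_0) simp
    then have "coeff r (Suc n) = 0" unfolding r_def using lx[of n] lc[of "Suc n"] by simp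
    ultimately show ?thesis by (metis le_SucE leading_coeff_0_iff degree_0 le0)
  qed
  have "ip r (P k) = 0" if k: "k \<le> n" for k
  proof -
    have e: "ip r (P k) = ip ([:0,1:] * P n) (P k) - ip (P (Suc n)) (P k) - b * ip L (P k)"
      unfolding r_def ip_comm[of _ "P k"] by (simp only: ip_diff ip_smult)
    have z: "ip (P (Suc n)) (P k) = 0" using orth k by simp
    consider "k = n" | "Suc k = n" | "Suc k < n" using k by linarith
    then show ?thesis
    proof cases
      case 1
      have "b * ip L (P k) = 0"
        unfolding L_def b_def recurrence_coeff_def using 1 orth by auto
      then show ?thesis using e z mid 1 by simp
    next
      case 2
      define d where "d = [:0,1:] * P k - P n"
      have "degree d \<le> n" unfolding d_def using dx[of k] deg[of n] 2 by (intro degree_diff_le) auto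
      moreover have "coeff d n = 0" unfolding d_def using lx[of k] lc[of n] 2 by (simp del: mult_pCons_left)
      ultimately have "d = 0 \<or> degree d < n" by (metis le_neq_implies_less leading_coeff_0_iff)
      then have "ip (P n) d = 0" using low ip_smult[of "P n" 0 0] by auto
      then have "ip (P n) ([:0,1:] * P k) = h n" unfolding d_def ip_diff using orth by simp
      moreover have "b * ip L (P k) = h n"
        using 2 orth[of k k] hne[of k] unfolding b_def L_def recurrence_coeff_def by auto
      ultimately show ?thesis using e z ip_x[of "P n" "P k"] by simp
    next
      case 3
      have "ip (P n) ([:0,1:] * P k) = 0" using low dx 3 by metis
      moreover have "ip L (P k) = 0" unfolding L_def using 3 orth by auto
      ultimately show ?thesis using e z ip_x[of "P n" "P k"] by simp
    qed
  qed
  then have "ip r r = 0" using span[of n r r] dr by blast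
  then have "r = 0" by (rule ip_pos)
  then show ?thesis unfolding r_def L_def b_def by (simp add: algebra_simps)
qed

end

(* Write y = 1 - x^2. The weight satisfies the Pearson equation y^2 w' = - V w with
   V = 2 \<alpha> x y + 2 t x, so the P_n obey a structure relation
     y^2 P_n' = \<beta>_n a_n P_{n-1} - b_n P_n,   a_n = p_n + q_n y,   b_n = x (r_n + n y),
   together with y^2 P_{n-1}' = (b_n + V) P_{n-1} - a_{n-1} P_n. Since P_n and P_{n-1} do not both vanish
   at x = 1, the determinant \<beta>_n a_n a_{n-1} - b_n (b_n + V) of this linear system vanishes to second
   order at x = 1. This gives two equations, quadratic in r_n, in which p_n and p_{n-1} are expressed by
   r_n and the \<beta>_k; eliminating r_n yields the difference equation. *)

theory Submission
  imports Defs
begin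

locale orthogonal_family =
  fixes \<alpha> t :: real and P :: "nat \<Rightarrow> real poly" and h :: "nat \<Rightarrow> real"
  assumes \<alpha>_pos: "\<alpha> > 0" and t_pos: "t > 0"
    and ortho: "monic_orthogonal (weight \<alpha> t) P h"
begin

abbreviation "\<beta> \<equiv> recurrence_coeff h"

section \<open>The inner product of the weight and its orthogonal polynomials\<close>

definition ip :: "real poly \<Rightarrow> real poly \<Rightarrow> real" where
  "ip p q = integral {-1..1} (\<lambda>x. poly p x * poly q x * weight \<alpha> t x)"

lemma continuous_on_ip: "continuous_on {-1..1} (\<lambda>x. poly p x * poly q x * weight \<alpha> t x)"
  by (intro continuous_intros continuous_on_weight \<alpha>_pos t_pos)

lemma integrable_ip: "(\<lambda>x. poly p x * poly q x * weight \<alpha> t x) integrable_on {-1..1}"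
  by (rule integrable_continuous_real[OF continuous_on_ip])

lemma ip_commute: "ip p q = ip q p"
  unfolding ip_def by (simp add: mult_ac)

lemma ip_add_right: "ip p (q + r) = ip p q + ip p r"
  unfolding ip_def integral_add[OF integrable_ip integrable_ip, symmetric]
  by (simp add: algebra_simps)

lemma ip_smult_right: "ip p (smult c q) = c * ip p q"
  unfolding ip_def integral_mult_right[symmetric] by (simp add: mult_ac)

lemma ip_diff_right: "ip p (q - r) = ip p q - ip p r"
  using ip_add_right[of p q "smult (-1) r"] ip_smult_right[of p "-1" r] by simp

lemma ip_add_left: "ip (p + q) r = ip p r + ip q r"
  using ip_add_right ip_commute by metis

lemma ip_diff_left: "ip (p - q) r = ip p r - ip q r"
  using ip_diff_right ip_commute by metis

lemma ip_smult_left: "ip (smult c p) q = c * ip p q"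
  using ip_smult_right ip_commute by metis

lemmas ip_linear = ip_add_left ip_add_right ip_diff_left ip_diff_right ip_smult_left ip_smult_right

lemma ip_mult_left: "ip (s * p) q = ip p (s * q)"
  unfolding ip_def by (simp add: mult_ac)

lemma ip_P: "ip (P m) (P n) = (if m = n then h n else 0)"
  using ortho unfolding monic_orthogonal_def ip_def by metis

lemma degree_P: "degree (P n) = n"
  using ortho unfolding monic_orthogonal_def by metis

lemma lead_coeff_P: "lead_coeff (P n) = 1"
  using ortho unfolding monic_orthogonal_def by metis

lemma P_0: "P 0 = 1"
  using degree_P[of 0] lead_coeff_P[of 0] by (auto elim: degree_eq_zeroE)

text \<open>A nonnegative continuous integrand with zero integral vanishes identically. The weight
  is positive on (0,1), so \<open>P n\<close> would have infinitely many roots there.\<close>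

lemma h_nonzero: "h n \<noteq> 0"
proof
  assume "h n = 0"
  then have "ip (P n) (P n) = 0" by (simp add: ip_P)
  then have "\<forall>x\<in>{-1..1}. poly (P n) x * poly (P n) x * weight \<alpha> t x = 0"
    using integral_eq_0_iff[OF continuous_on_ip, of "P n" "P n"]
    unfolding ip_def by (auto simp: weight_def)
  then have "{0<..<1} \<subseteq> {x. poly (P n) x = 0}"
    by (force simp: weight_def abs_square_eq_1 power2_eq_1_iff)
  moreover have "P n \<noteq> 0" using lead_coeff_P[of n] by auto
  ultimately have "finite {0<..<1::real}"
    using poly_roots_finite finite_subset by blast
  then show False by (simp add: infinite_Ioo)
qed

lemma \<beta>_0: "\<beta> 0 = 0"
  by (simp add: recurrence_coeff_def)

lemma h_Suc: "h (Suc n) = \<beta> (Suc n) * h n"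
  using h_nonzero by (simp add: recurrence_coeff_def)

text \<open>For \<open>n = 0\<close> the junk value \<open>P (0 - 1) = P 0\<close> is harmless because of the factor \<open>\<beta> 0 = 0\<close>.\<close>

lemma recurrence: "[:0, 1:] * P n = P (Suc n) + smult (\<beta> n) (P (n - 1))"
  using three_term_recurrence[OF \<alpha>_pos t_pos ortho, of n] by (cases n) (simp_all add: \<beta>_0)

section \<open>Pearson equation and integration by parts\<close>

definition \<sigma> :: "real poly" where "\<sigma> = [:1, 0, -1:]\<^sup>2"

definition V :: "real poly" where "V = [:0, 2 * \<alpha> + 2 * t, 0, - 2 * \<alpha>:]"

lemma poly_\<sigma>: "poly \<sigma> x = (1 - x\<^sup>2)\<^sup>2"
  by (simp add: \<sigma>_def power2_eq_square algebra_simps)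

lemma poly_V: "poly V x = 2 * \<alpha> * x * (1 - x\<^sup>2) + 2 * t * x"
  by (simp add: V_def power2_eq_square algebra_simps)

lemma DERIV_weight:
  assumes "- 1 < x" "x < 1"
  shows "(weight \<alpha> t has_real_derivative
    weight \<alpha> t x * (- 2 * \<alpha> * x / (1 - x\<^sup>2) - 2 * t * x / (1 - x\<^sup>2)\<^sup>2)) (at x)"
proof -
  have pos: "1 - x\<^sup>2 > 0" using assms by (simp add: abs_square_less_1 abs_less_iff)
  have "((\<lambda>x. (1 - x\<^sup>2) powr \<alpha>) has_real_derivative \<alpha> * (1 - x\<^sup>2) powr (\<alpha> - 1) * (- 2 * x)) (at x)"
    using pos by (auto intro!: derivative_eq_intros)
  moreover have "((\<lambda>x. - t / (1 - x\<^sup>2)) has_real_derivative - 2 * t * x / (1 - x\<^sup>2)\<^sup>2) (at x)"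
    using pos by (auto intro!: derivative_eq_intros simp: power2_eq_square)
  ultimately have "((\<lambda>x. (1 - x\<^sup>2) powr \<alpha> * exp (- t / (1 - x\<^sup>2))) has_real_derivative
      \<alpha> * (1 - x\<^sup>2) powr (\<alpha> - 1) * (- 2 * x) * exp (- t / (1 - x\<^sup>2))
      + exp (- t / (1 - x\<^sup>2)) * (- 2 * t * x / (1 - x\<^sup>2)\<^sup>2) * (1 - x\<^sup>2) powr \<alpha>) (at x)"
    by (intro DERIV_mult DERIV_chain2[OF DERIV_exp])
  also have "(1 - x\<^sup>2) powr (\<alpha> - 1) = (1 - x\<^sup>2) powr \<alpha> / (1 - x\<^sup>2)"
    using pos by (simp add: powr_diff)
  finally show ?thesis
    by (simp add: weight_def[abs_def] algebra_simps)
qed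

text \<open>This is the integral of the derivative of \<open>\<sigma> * p * q\<close> times the
  weight, where \<open>\<sigma>\<close> clears the poles of the logarithmic derivative of the
  weight. The boundary terms vanish because the weight is 0 at both endpoints; differentiation takes
  place in the open interval only.\<close>

lemma Pearson_by_parts:
  "ip (\<sigma> * pderiv p) q + ip p (\<sigma> * pderiv q) = ip p ((V - pderiv \<sigma>) * q)"
proof -
  let ?G = "\<lambda>x. poly (\<sigma> * p) x * poly q x * weight \<alpha> t x"
  define g where "g x = poly (\<sigma> * pderiv p) x * poly q x * weight \<alpha> t x
      + poly p x * poly (\<sigma> * pderiv q) x * weight \<alpha> t x
      - poly p x * poly ((V - pderiv \<sigma>) * q) x * weight \<alpha> t x" for x
  have "(g has_integral ?G 1 - ?G (-1)) {-1..1}"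
  proof (rule fundamental_theorem_of_calculus_interior)
    fix x :: real assume x: "x \<in> {-1<..<1}"
    then have pos: "1 - x\<^sup>2 > 0" by (simp add: abs_square_less_1 abs_less_iff)
    have w: "(weight \<alpha> t has_real_derivative
      weight \<alpha> t x * (- 2 * \<alpha> * x / (1 - x\<^sup>2) - 2 * t * x / (1 - x\<^sup>2)\<^sup>2)) (at x)"
      using x by (intro DERIV_weight) auto
    have "y\<^sup>2 * (- 2 * \<alpha> * x / y - 2 * t * x / y\<^sup>2) = - (2 * \<alpha> * x * y + 2 * t * x)" if "y > 0" for y
      using that by (simp add: field_simps power2_eq_square)
    from this[OF pos]
    have V: "poly \<sigma> x * (- 2 * \<alpha> * x / (1 - x\<^sup>2) - 2 * t * x / (1 - x\<^sup>2)\<^sup>2) = - poly V x"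
      by (simp only: poly_\<sigma> poly_V)
    have "(?G has_real_derivative
        (poly (pderiv (\<sigma> * p)) x * poly q x + poly (pderiv q) x * poly (\<sigma> * p) x) * weight \<alpha> t x
        + weight \<alpha> t x * (- 2 * \<alpha> * x / (1 - x\<^sup>2) - 2 * t * x / (1 - x\<^sup>2)\<^sup>2)
          * (poly (\<sigma> * p) x * poly q x)) (at x)"
      by (intro DERIV_mult w poly_DERIV)
    also have "weight \<alpha> t x * (- 2 * \<alpha> * x / (1 - x\<^sup>2) - 2 * t * x / (1 - x\<^sup>2)\<^sup>2)
          * (poly (\<sigma> * p) x * poly q x)
        = (poly \<sigma> x * (- 2 * \<alpha> * x / (1 - x\<^sup>2) - 2 * t * x / (1 - x\<^sup>2)\<^sup>2))
          * (poly p x * poly q x * weight \<alpha> t x)"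
      by (simp only: poly_mult mult_ac)
    finally show "(?G has_vector_derivative g x) (at x)"
      unfolding V has_real_derivative_iff_has_vector_derivative[symmetric]
      by (simp add: g_def pderiv_mult algebra_simps)
  qed (use continuous_on_ip[of "\<sigma> * p" q] in simp_all)
  then have "integral {-1..1} g = 0"
    by (simp add: integral_unique weight_def)
  moreover have "integral {-1..1} g =
      ip (\<sigma> * pderiv p) q + ip p (\<sigma> * pderiv q) - ip p ((V - pderiv \<sigma>) * q)"
    unfolding g_def ip_def
    using integral_diff[OF integrable_add[OF integrable_ip integrable_ip] integrable_ip]
      integral_add[OF integrable_ip integrable_ip] by presburger
  ultimately show ?thesis by simp
qed

section \<open>Coefficients of the structure relation\<close>

text \<open>The recursion for \<open>r\<close> and the formula for \<open>p\<close> are forced by the compatibility of the structure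
  relation with the three-term recurrence. The one remaining compatibility condition is
  \<open>Laguerre_Freud\<close> below, which needs orthogonality.\<close>

primrec r :: "nat \<Rightarrow> real" where
  "r 0 = 0"
| "r (Suc n) = r n + 1 - (2 * real n + 3 + 2 * \<alpha>) * \<beta> (Suc n) + (2 * real n - 1 + 2 * \<alpha>) * \<beta> n"

definition p :: "nat \<Rightarrow> real" where "p n = r (Suc n) + r n + 2 * t"

text \<open>With y = 1 - x^2, the sum \<open>b (Suc n) + b n + V\<close> is x times a linear
  polynomial in y; \<open>q n\<close> is its y-coefficient and \<open>p n\<close> its constant
  term.\<close>

definition q :: "nat \<Rightarrow> real" where "q n = 2 * real n + 1 + 2 * \<alpha>"

definition a :: "nat \<Rightarrow> real poly" where "a n = [:p n + q n, 0, - q n:]"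

definition b :: "nat \<Rightarrow> real poly" where "b n = [:0, r n + real n, 0, - real n:]"

lemma poly_a: "poly (a n) x = p n + q n * (1 - x\<^sup>2)"
  by (simp add: a_def power2_eq_square algebra_simps)

lemma poly_b: "poly (b n) x = x * (r n + real n * (1 - x\<^sup>2))"
  by (simp add: b_def power2_eq_square algebra_simps)

lemma b_Suc: "b (Suc n) = [:0, 1:] * a n - b n - V"
  by (simp add: a_def b_def V_def p_def q_def algebra_simps)

section \<open>Matrix entries of multiplication by powers of x\<close>

text \<open>Naming the monomial keeps products \<open>X * f\<close> intact under simplification, so
  that they match the matrix entries below.\<close>

definition X :: "real poly" where "X = [:0, 1:]"

lemma poly_X: "poly X x = x"
  by (simp add: X_def)

lemma X_mult_P: "X * P n = P (Suc n) + smult (\<beta> n) (P (n - 1))"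
  unfolding X_def by (rule recurrence)

lemma ip_X_P: "ip (X * P n) (P (Suc n)) = h (Suc n)"
  unfolding X_mult_P by (simp add: ip_linear ip_P)

lemma ip_X_P_X_P: "ip (X * P n) (X * P n) = (\<beta> n + \<beta> (Suc n)) * h n"
  unfolding X_mult_P by (cases n) (simp_all add: ip_linear ip_P \<beta>_0 h_Suc algebra_simps)

lemma ip_X_P_X_P_Suc_Suc: "ip (X * P n) (X * P (Suc (Suc n))) = h (Suc (Suc n))"
  unfolding X_mult_P by (cases n) (simp_all add: ip_linear ip_P \<beta>_0 h_Suc algebra_simps)

lemma ip_X_X_P_X_P:
  "ip (X * (X * P n)) (X * P (Suc n)) = (\<beta> n + \<beta> (Suc n) + \<beta> (Suc (Suc n))) * h (Suc n)"
proof -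
  have "ip (X * (X * P n)) (X * P (Suc n)) = ip (X * P n) (X * (X * P (Suc n)))"
    by (rule ip_mult_left)
  also have "X * (X * P (Suc n)) = X * P (Suc (Suc n)) + smult (\<beta> (Suc n)) (X * P n)"
    unfolding X_mult_P[of "Suc n"] by (simp add: distrib_left)
  finally show ?thesis
    by (simp add: ip_linear ip_X_P_X_P ip_X_P_X_P_Suc_Suc h_Suc algebra_simps)
qed

lemma a_mult: "a n * f = smult (p n + q n) f - smult (q n) (X * (X * f))"
  by (simp add: a_def X_def algebra_simps)

lemma b_mult: "b n * f = smult (r n + real n) (X * f) - smult (real n) (X * (X * (X * f)))"
  by (simp add: b_def X_def algebra_simps)

lemma V_pderiv_mult:
  "(V - pderiv \<sigma>) * f = smult (2 * \<alpha> + 4 + 2 * t) (X * f) - smult (2 * \<alpha> + 4) (X * (X * (X * f)))"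
proof -
  have "V - pderiv \<sigma> = [:0, 2 * \<alpha> + 4 + 2 * t, 0, - (2 * \<alpha> + 4):]"
    by (simp add: V_def \<sigma>_def power2_eq_square pderiv_pCons)
  moreover have "[:0, c, 0, - d:] * f = smult c (X * f) - smult d (X * (X * (X * f)))" for c d
    by (simp add: X_def)
  ultimately show ?thesis by (simp only:)
qed

section \<open>The two structure relations\<close>

definition lowering :: "nat \<Rightarrow> bool" where
  "lowering n \<longleftrightarrow> \<sigma> * pderiv (P n) = smult (\<beta> n) (a n * P (n - 1)) - b n * P n"

text \<open>The factor \<open>\<beta> n\<close> on both sides makes the relation trivially true for
  n = 0, where \<open>n - 1\<close> truncates.\<close>

definition raising :: "nat \<Rightarrow> bool" where
  "raising n \<longleftrightarrow> smult (\<beta> n) (\<sigma> * pderiv (P (n - 1))) =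
     smult (\<beta> n) ((b n + V) * P (n - 1) - a (n - 1) * P n)"

lemma lowering_poly:
  assumes "lowering n"
  shows "poly \<sigma> x * poly (pderiv (P n)) x =
    \<beta> n * (poly (a n) x * poly (P (n - 1)) x) - poly (b n) x * poly (P n) x"
  using arg_cong[OF assms[unfolded lowering_def], of "\<lambda>f. poly f x"] by simp

lemma raising_poly:
  assumes "raising n"
  shows "\<beta> n * (poly \<sigma> x * poly (pderiv (P (n - 1))) x) =
    \<beta> n * ((poly (b n) x + poly V x) * poly (P (n - 1)) x - poly (a (n - 1)) x * poly (P n) x)"
  using arg_cong[OF assms[unfolded raising_def], of "\<lambda>f. poly f x"] by simp

lemma poly_P_Suc: "poly (P (Suc n)) x = x * poly (P n) x - \<beta> n * poly (P (n - 1)) x"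
  using arg_cong[OF recurrence[of n], of "\<lambda>f. poly f x"] by simp

lemma poly_b_Suc: "poly (b (Suc n)) x = x * poly (a n) x - poly (b n) x - poly V x"
  unfolding b_Suc by simp

text \<open>Substituting x \<open>a n\<close> - \<open>b n\<close> for \<open>b (Suc n) + V\<close>
  and eliminating \<open>P (Suc n)\<close> by the recurrence turns the new relation into
  \<open>lowering n\<close>.\<close>

lemma raising_Suc:
  assumes "lowering n"
  shows "raising (Suc n)"
proof -
  have "\<sigma> * pderiv (P n) = (b (Suc n) + V) * P n - a n * P (Suc n)"
  proof (rule poly_ext)
    fix x
    show "poly (\<sigma> * pderiv (P n)) x = poly ((b (Suc n) + V) * P n - a n * P (Suc n)) x"
      using lowering_poly[OF assms, of x]
      by (simp add: poly_b_Suc poly_P_Suc algebra_simps)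
  qed
  then show ?thesis by (simp add: raising_def)
qed

text \<open>Differentiating the three-term recurrence and inserting both relations gives the next
  lowering relation up to a constant multiple \<open>c\<close> of \<open>P n\<close>; showing
  \<open>c = 0\<close> is left to \<open>Laguerre_Freud\<close>.\<close>

lemma lowering_defect:
  assumes "lowering n" "raising n"
  defines "c \<equiv> r (Suc n) - r n - \<beta> (Suc n) * p (Suc n) + \<beta> n * p (n - 1)"
  shows "\<sigma> * pderiv (P (Suc n)) =
    smult (\<beta> (Suc n)) (a (Suc n) * P n) - b (Suc n) * P (Suc n) + smult c (P n)"
proof (rule poly_ext)
  fix x
  have "P (Suc n) = X * P n - smult (\<beta> n) (P (n - 1))"
    by (simp add: X_mult_P)
  then have "pderiv (P (Suc n)) = P n + X * pderiv (P n) - smult (\<beta> n) (pderiv (P (n - 1)))"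
    by (simp add: pderiv_mult pderiv_diff pderiv_smult X_def pderiv_pCons)
  then have "poly (pderiv (P (Suc n))) x =
      poly (P n) x + x * poly (pderiv (P n)) x - \<beta> n * poly (pderiv (P (n - 1))) x"
    by (simp add: poly_X)
  from arg_cong[OF this, of "(*) (poly \<sigma> x)"]
  have "poly \<sigma> x * poly (pderiv (P (Suc n))) x = poly \<sigma> x * poly (P n) x
      + x * (poly \<sigma> x * poly (pderiv (P n)) x) - \<beta> n * (poly \<sigma> x * poly (pderiv (P (n - 1))) x)"
    by (simp add: algebra_simps)
  \<comment> \<open>The terms in \<open>P (n - 1)\<close> add up to \<open>\<beta> n\<close>
    \<open>b (Suc n)\<close> \<open>P (n - 1)\<close>, and the recurrence rewrites
    \<open>\<beta> n\<close> \<open>P (n - 1)\<close> as x \<open>P n\<close> -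
    \<open>P (Suc n)\<close>.\<close>
  also have "\<dots> = (poly \<sigma> x - x * poly (b n) x + \<beta> n * poly (a (n - 1)) x + x * poly (b (Suc n)) x)
      * poly (P n) x - poly (b (Suc n)) x * poly (P (Suc n)) x"
    unfolding lowering_poly[OF assms(1)] raising_poly[OF assms(2)] poly_b_Suc poly_P_Suc
    by (simp add: algebra_simps)
  also have "poly \<sigma> x - x * poly (b n) x + \<beta> n * poly (a (n - 1)) x + x * poly (b (Suc n)) x
      = \<beta> (Suc n) * poly (a (Suc n)) x + c"
  proof -
    define y where "y = 1 - x\<^sup>2"
    define s where "s = r (Suc n) - r n"
    \<comment> \<open>For n = 0 the values of \<open>q (n - 1)\<close> and of the formula differ,
      but \<open>\<beta> 0 = 0\<close> hides this.\<close>
    have "\<beta> n * q (n - 1) = \<beta> n * (2 * real n - 1 + 2 * \<alpha>)"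
      by (cases n) (simp_all add: \<beta>_0 q_def)
    then have s: "s = 1 - q (Suc n) * \<beta> (Suc n) + \<beta> n * q (n - 1)"
      by (simp add: s_def q_def algebra_simps)
    have "poly \<sigma> x - x * poly (b n) x + \<beta> n * poly (a (n - 1)) x + x * poly (b (Suc n)) x
        = y\<^sup>2 + x\<^sup>2 * (s + y) + \<beta> n * p (n - 1) + \<beta> n * q (n - 1) * y"
      unfolding poly_\<sigma> poly_a poly_b y_def[symmetric] s_def
      by (simp add: power2_eq_square algebra_simps del: r.simps)
    \<comment> \<open>Now everything is a polynomial in y: the squares cancel, the recursion for
      \<open>r\<close> matches the linear terms, and the constant terms differ by
      \<open>c\<close>.\<close>
    also have "x\<^sup>2 = 1 - y" by (simp add: y_def)
    also have "y\<^sup>2 + (1 - y) * (s + y) + \<beta> n * p (n - 1) + \<beta> n * q (n - 1) * y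
        = s + \<beta> n * p (n - 1) + y * (1 + \<beta> n * q (n - 1) - s)"
      by (simp add: power2_eq_square algebra_simps)
    also have "1 + \<beta> n * q (n - 1) - s = q (Suc n) * \<beta> (Suc n)"
      unfolding s by simp
    also have "s + \<beta> n * p (n - 1) + y * (q (Suc n) * \<beta> (Suc n)) = \<beta> (Suc n) * poly (a (Suc n)) x + c"
      unfolding poly_a y_def[symmetric] c_def s_def by (simp add: algebra_simps del: r.simps)
    finally show ?thesis .
  qed
  finally show "poly (\<sigma> * pderiv (P (Suc n))) x =
      poly (smult (\<beta> (Suc n)) (a (Suc n) * P n) - b (Suc n) * P (Suc n) + smult c (P n)) x"
    by (simp add: algebra_simps)
qed

text \<open>Integration by parts is applied to \<open>P (Suc n)\<close> and \<open>P n\<close>. By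
  orthogonality the defect contributes \<open>?c * h n\<close>, while all other terms are multiples
  of \<open>h (Suc n)\<close> whose coefficients sum to zero.\<close>

lemma Laguerre_Freud:
  assumes "lowering n" "raising n"
  shows "r (Suc n) - r n - \<beta> (Suc n) * p (Suc n) + \<beta> n * p (n - 1) = 0" (is "?c = 0")
proof -
  let ?S = "1 - \<beta> n - \<beta> (Suc n) - \<beta> (Suc (Suc n))"
  have X3: "ip (P (Suc n)) (X * (X * (X * P n))) = (\<beta> n + \<beta> (Suc n) + \<beta> (Suc (Suc n))) * h (Suc n)"
    using ip_X_X_P_X_P[of n] by (metis ip_commute ip_mult_left)
  have X1: "ip (P (Suc n)) (X * P n) = h (Suc n)"
    using ip_X_P[of n] by (metis ip_commute)
  have X2: "ip (P n) (X * (X * P n)) = (\<beta> n + \<beta> (Suc n)) * h n"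
    using ip_X_P_X_P[of n] by (simp add: ip_mult_left)
  have X2': "\<beta> n * ip (P (Suc n)) (X * (X * P (n - 1))) = \<beta> n * h (Suc n)"
  proof (cases n)
    case (Suc m)
    then show ?thesis
      using ip_X_P_X_P_Suc_Suc[of m] ip_mult_left[of X "P (Suc n)" "X * P m"]
      by (simp add: ip_commute[of "X * P m"])
  qed (simp add: \<beta>_0)
  have "ip (\<sigma> * pderiv (P (Suc n))) (P n) =
      \<beta> (Suc n) * ip (P n) (a (Suc n) * P n) - ip (P (Suc n)) (b (Suc n) * P n) + ?c * h n"
    unfolding lowering_defect[OF assms]
    by (simp add: ip_linear ip_P ip_mult_left del: r.simps)
  also have "ip (P n) (a (Suc n) * P n) = (p (Suc n) + q (Suc n) * (1 - \<beta> n - \<beta> (Suc n))) * h n"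
    unfolding a_mult by (simp add: ip_linear ip_P X2 algebra_simps)
  also have "ip (P (Suc n)) (b (Suc n) * P n) = (r (Suc n) + real (Suc n) * ?S) * h (Suc n)"
    unfolding b_mult by (simp add: ip_linear X1 X3 algebra_simps del: r.simps)
  finally have 1: "ip (\<sigma> * pderiv (P (Suc n))) (P n) =
      (p (Suc n) + q (Suc n) * (1 - \<beta> n - \<beta> (Suc n)) - r (Suc n) - real (Suc n) * ?S) * h (Suc n)
      + ?c * h n"
    by (simp add: h_Suc algebra_simps del: r.simps)
  have "ip (P (Suc n)) (\<sigma> * pderiv (P n)) =
      \<beta> n * ip (P (Suc n)) (a n * P (n - 1)) - ip (P (Suc n)) (b n * P n)"
    using assms(1) unfolding lowering_def by (simp add: ip_linear)
  also have "\<beta> n * ip (P (Suc n)) (a n * P (n - 1)) = - q n * (\<beta> n * ip (P (Suc n)) (X * (X * P (n - 1))))"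
  proof -
    have "ip (P (Suc n)) (P (n - 1)) = 0" by (subst ip_P) auto
    then show ?thesis unfolding a_mult by (simp add: ip_linear)
  qed
  also have "\<dots> = - q n * \<beta> n * h (Suc n)"
    unfolding X2' by simp
  also have "ip (P (Suc n)) (b n * P n) = (r n + real n * ?S) * h (Suc n)"
    unfolding b_mult by (simp add: ip_linear X1 X3 algebra_simps del: r.simps)
  finally have 2: "ip (P (Suc n)) (\<sigma> * pderiv (P n)) = - (q n * \<beta> n + r n + real n * ?S) * h (Suc n)"
    by (simp add: algebra_simps del: r.simps)
  have 3: "ip (P (Suc n)) ((V - pderiv \<sigma>) * P n) = ((2 * \<alpha> + 4) * ?S + 2 * t) * h (Suc n)"
    unfolding V_pderiv_mult by (simp add: ip_linear X1 X3 algebra_simps del: r.simps)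
  \<comment> \<open>The terms in \<open>p\<close>, \<open>r\<close> and \<open>t\<close> reduce to
    \<open>r (Suc (Suc n)) - r n\<close>, so two steps of the recursion for \<open>r\<close> give
    the identity.\<close>
  have 4: "p (Suc n) + q (Suc n) * (1 - \<beta> n - \<beta> (Suc n)) - r (Suc n) - real (Suc n) * ?S
      - (q n * \<beta> n + r n + real n * ?S) - ((2 * \<alpha> + 4) * ?S + 2 * t) = 0"
    by (simp add: p_def q_def algebra_simps)
  have "?c * h n + (p (Suc n) + q (Suc n) * (1 - \<beta> n - \<beta> (Suc n)) - r (Suc n) - real (Suc n) * ?S
      - (q n * \<beta> n + r n + real n * ?S) - ((2 * \<alpha> + 4) * ?S + 2 * t)) * h (Suc n) = 0"
    using Pearson_by_parts[of "P (Suc n)" "P n"] unfolding 1 2 3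
    by (simp add: algebra_simps del: r.simps)
  then show ?thesis unfolding 4 using h_nonzero by simp
qed

text \<open>The induction must carry both relations, since the defect formula at n uses
  both.\<close>

lemma lowering_raising: "lowering n \<and> raising n"
proof (induction n)
  case 0
  show ?case by (simp add: lowering_def raising_def \<beta>_0 P_0 b_def)
next
  case (Suc n)
  have "lowering (Suc n)"
    unfolding lowering_def
    using lowering_defect[of n] Laguerre_Freud[of n] Suc by simp
  then show ?case using raising_Suc Suc by blast
qed

section \<open>The double zero of the determinant\<close>

text \<open>Since every \<open>\<beta> (Suc n)\<close> is nonzero, the recurrence would pass a
  common zero of two neighbours down to \<open>P 0 = 1\<close>.\<close>

lemma P_Suc_nonzero_at_1: "poly (P (Suc n)) 1 \<noteq> 0 \<or> poly (P n) 1 \<noteq> 0"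
proof (induction n)
  case 0
  show ?case by (simp add: P_0)
next
  case (Suc n)
  have "\<beta> (Suc n) \<noteq> 0" using h_nonzero by (simp add: recurrence_coeff_def)
  then show ?case using Suc poly_P_Suc[of "Suc n" 1] by auto
qed

definition D :: "nat \<Rightarrow> real poly" where
  "D n = smult (\<beta> (Suc n)) (a (Suc n) * a n) - b (Suc n) * (b (Suc n) + V)"

lemma \<sigma>_dvd_imp_double_root:
  assumes "\<sigma> dvd f"
  shows "poly f 1 = 0" "poly (pderiv f) 1 = 0"
proof -
  have \<sigma>: "poly \<sigma> 1 = 0" "poly (pderiv \<sigma>) 1 = 0"
    by (simp_all add: \<sigma>_def power2_eq_square pderiv_pCons)
  then show "poly f 1 = 0" "poly (pderiv f) 1 = 0"
    using assms by (auto elim!: dvdE simp: pderiv_mult)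
qed

text \<open>By Cramer's rule, \<open>D n\<close> times either of \<open>P (Suc n)\<close> and
  \<open>P n\<close> is a multiple of \<open>\<sigma>\<close>. One of these two is nonzero at 1, so
  the double zero belongs to \<open>D n\<close>.\<close>

lemma double_root_D: "poly (D n) 1 = 0" "poly (pderiv (D n)) 1 = 0"
proof -
  have E: "\<sigma> * pderiv (P (Suc n)) = smult (\<beta> (Suc n)) (a (Suc n) * P n) - b (Suc n) * P (Suc n)"
    using lowering_raising[of "Suc n"] by (simp add: lowering_def)
  have "\<beta> (Suc n) \<noteq> 0" using h_nonzero by (simp add: recurrence_coeff_def)
  moreover have "smult (\<beta> (Suc n)) (\<sigma> * pderiv (P n) - ((b (Suc n) + V) * P n - a n * P (Suc n))) = 0"
    using lowering_raising[of "Suc n"] unfolding raising_def smult_diff_right by simp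
  ultimately have F: "\<sigma> * pderiv (P n) = (b (Suc n) + V) * P n - a n * P (Suc n)"
    by simp
  have "D n * P (Suc n) = \<sigma> * ((b (Suc n) + V) * pderiv (P (Suc n)) - smult (\<beta> (Suc n)) (a (Suc n) * pderiv (P n)))"
  proof -
    have "\<sigma> * ((b (Suc n) + V) * pderiv (P (Suc n)) - smult (\<beta> (Suc n)) (a (Suc n) * pderiv (P n)))
      = (b (Suc n) + V) * (\<sigma> * pderiv (P (Suc n))) - smult (\<beta> (Suc n)) (a (Suc n) * (\<sigma> * pderiv (P n)))"
      by (simp add: algebra_simps)
    then show ?thesis unfolding E F D_def by (simp add: algebra_simps smult_diff_right smult_add_right)
  qed
  then have 1: "\<sigma> dvd D n * P (Suc n)" by simp
  have "D n * P n = \<sigma> * (a n * pderiv (P (Suc n)) - b (Suc n) * pderiv (P n))"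
  proof -
    have "\<sigma> * (a n * pderiv (P (Suc n)) - b (Suc n) * pderiv (P n))
      = a n * (\<sigma> * pderiv (P (Suc n))) - b (Suc n) * (\<sigma> * pderiv (P n))"
      by (simp add: algebra_simps)
    then show ?thesis unfolding E F D_def by (simp add: algebra_simps smult_diff_right smult_add_right)
  qed
  then have 2: "\<sigma> dvd D n * P n" by simp
  show "poly (D n) 1 = 0"
    using \<sigma>_dvd_imp_double_root(1)[OF 1] \<sigma>_dvd_imp_double_root(1)[OF 2] P_Suc_nonzero_at_1[of n]
    by auto
  \<comment> \<open>As \<open>D n\<close> is zero at 1, the product rule leaves only its derivative
    times the value of \<open>P (Suc n)\<close> or \<open>P n\<close>.\<close>
  then show "poly (pderiv (D n)) 1 = 0"
    using \<sigma>_dvd_imp_double_root(2)[OF 1] \<sigma>_dvd_imp_double_root(2)[OF 2] P_Suc_nonzero_at_1[of n]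
    by (auto simp: pderiv_mult)
qed

text \<open>At x = 1, where y = 0 and dy/dx = -2, these are the value of the determinant and its
  derivative divided by -2.\<close>

lemma quadratic_relations:
  fixes n
  defines "s \<equiv> r (Suc n)"
  shows "s * (s + 2 * t) = \<beta> (Suc n) * p (Suc n) * p n"
    and "2 * s * real (Suc n) + 2 * t * real (Suc n) + 2 * \<alpha> * s - s * (s + 2 * t)
      = \<beta> (Suc n) * (p (Suc n) * q n + q (Suc n) * p n)"
proof -
  show 1: "s * (s + 2 * t) = \<beta> (Suc n) * p (Suc n) * p n"
    using double_root_D(1)[of n]
    by (simp add: D_def poly_a poly_b poly_V s_def del: r.simps)
  have "poly (pderiv (D n)) 1 = \<beta> (Suc n) * (p (Suc n) * (- 2 * q n) + p n * (- 2 * q (Suc n)))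
      - (s * (s - 2 * real (Suc n) + 2 * t - 4 * \<alpha>) + (s + 2 * t) * (s - 2 * real (Suc n)))"
    by (simp add: D_def a_def b_def V_def pderiv_mult pderiv_diff pderiv_smult pderiv_add pderiv_pCons
        s_def algebra_simps del: r.simps mult_pCons_left mult_pCons_right)
  then show "2 * s * real (Suc n) + 2 * t * real (Suc n) + 2 * \<alpha> * s - s * (s + 2 * t)
      = \<beta> (Suc n) * (p (Suc n) * q n + q (Suc n) * p n)"
    using double_root_D(2)[of n] by (simp add: algebra_simps del: r.simps)
qed

end

section \<open>Elimination of \<open>r n\<close>\<close>

theorem theorem2p2:
  fixes \<alpha> t :: real and P :: "nat \<Rightarrow> real poly" and h \<beta> :: "nat \<Rightarrow> real" and n :: nat
  assumes "\<alpha> > 0" and "t > 0"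
    and "monic_orthogonal (weight \<alpha> t) P h"
    and "\<And>k. \<beta> k = recurrence_coeff h k"
    and "n \<ge> 1"
  shows
    "let bm = (2 * real n - 3 + 2 * \<alpha>) * \<beta> (n - 1);
         bp = (2 * real n + 3 + 2 * \<alpha>) * \<beta> (n + 1)
     in ((68 * (real n + \<alpha>)\<^sup>2 - 9) * \<beta> n ^ 3
         + (12 - 80 * (real n + \<alpha>)\<^sup>2 + (14 * real n + 5 + 14 * \<alpha>) * bm
            + (14 * real n - 5 + 14 * \<alpha>) * bp) * (\<beta> n)\<^sup>2
         + (24 * (real n + \<alpha>)\<^sup>2 + 4 * t * (t - 2 * \<alpha>) - 3
            - 2 * (2 * real n + 1 + 2 * \<alpha>) * bm - 2 * (2 * real n - 1 + 2 * \<alpha>) * bp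
            + bm * bp) * \<beta> n
         - 2 * ((real n + \<alpha>)\<^sup>2 - t * \<alpha>))\<^sup>2
      = 4 * (2 * (2 * real n - 1 + 2 * \<alpha>) * (2 * real n + 1 + 2 * \<alpha>) * (\<beta> n)\<^sup>2
             + ((2 * real n + 1 + 2 * \<alpha>) * bm + (2 * real n - 1 + 2 * \<alpha>) * bp
                - 2 * (2 * real n - 1 + 2 * \<alpha>) * (2 * real n + 1 + 2 * \<alpha>)) * \<beta> n
             + (real n + \<alpha>)\<^sup>2 + t * (t - 2 * \<alpha>))
          * (12 * (real n + \<alpha>) * (\<beta> n)\<^sup>2 + (bm + bp - 8 * (real n + \<alpha>)) * \<beta> n
             + real n + \<alpha>)\<^sup>2"
proof -
  interpret orthogonal_family \<alpha> t P h
    using assms by unfold_locales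
  obtain m where n: "n = Suc m" using assms(5) by (cases n) auto
  have [simp]: "\<beta> = recurrence_coeff h" using assms(4) by blast
  define N where "N = real n + \<alpha>"
  define B where "B = \<beta> n"
  define bm where "bm = (2 * real n - 3 + 2 * \<alpha>) * \<beta> (n - 1)"
  define bp where "bp = (2 * real n + 3 + 2 * \<alpha>) * \<beta> (n + 1)"
  \<comment> \<open>This shift of \<open>r n\<close> completes the square in the second quadratic
    relation.\<close>
  define S where "S = r n + t - N * (1 - 4 * B)"
  have rm: "r m = r n - 1 + (2 * N + 1) * B - bm"
    by (simp add: n N_def B_def bm_def algebra_simps)
  have rp: "r (Suc n) = r n + 1 - bp + (2 * N - 1) * B"
    by (simp add: N_def B_def bp_def algebra_simps)
  \<comment> \<open>\<open>E\<close> and \<open>F\<close> are the increments from \<open>r n\<close>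
    to \<open>r (Suc n)\<close> and to \<open>r m\<close>, free of \<open>r n\<close>
    itself.\<close>
  define E where "E = 1 - bp + (2 * N - 1) * B"
  define F where "F = - 1 + (2 * N + 1) * B - bm"
  have pn: "p n = 2 * (r n + t) + E"
    by (simp add: p_def rp E_def del: r.simps)
  have pm: "p m = 2 * (r n + t) + F"
    by (simp add: p_def rm F_def n[symmetric] del: r.simps)
  have qn: "q n = 2 * N + 1" "q m = 2 * N - 1"
    by (simp_all add: q_def N_def n)
  have 1: "r n * (r n + 2 * t) = B * (2 * (r n + t) + E) * (2 * (r n + t) + F)"
    using quadratic_relations(1)[of m] unfolding n[symmetric] pn pm by (simp add: B_def)
  have 2: "2 * N * (r n + t) - 2 * \<alpha> * t - r n * (r n + 2 * t)
      = B * ((2 * (r n + t) + E) * (2 * N - 1) + (2 * N + 1) * (2 * (r n + t) + F))"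
    using quadratic_relations(2)[of m] unfolding n[symmetric] pn pm qn
    by (simp add: B_def N_def algebra_simps)
  define \<Delta> where "\<Delta> = 2 * (2 * N - 1) * (2 * N + 1) * B\<^sup>2
    + ((2 * N + 1) * bm + (2 * N - 1) * bp - 2 * (2 * N - 1) * (2 * N + 1)) * B + N\<^sup>2 + t * (t - 2 * \<alpha>)"
  define Y where "Y = 12 * N * B\<^sup>2 + (bm + bp - 8 * N) * B + N"
  define Z where "Z = (68 * N\<^sup>2 - 9) * B ^ 3
    + (12 - 80 * N\<^sup>2 + (14 * N + 5) * bm + (14 * N - 5) * bp) * B\<^sup>2
    + (24 * N\<^sup>2 + 4 * t * (t - 2 * \<alpha>) - 3 - 2 * (2 * N + 1) * bm - 2 * (2 * N - 1) * bp + bm * bp) * B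
    - 2 * (N\<^sup>2 - t * \<alpha>)"
  have \<Delta>: "S\<^sup>2 = \<Delta>"
    using 2 unfolding S_def \<Delta>_def E_def F_def by algebra
  have "r n = S - t + N * (1 - 4 * B)"
    by (simp add: S_def)
  \<comment> \<open>Replacing the square of \<open>S\<close> by \<open>\<Delta>\<close> makes the
    first relation linear in \<open>S\<close>, with coefficient \<open>2 * Y\<close>;
    \<open>Z\<close> collects the remaining terms.\<close>
  with 1 \<Delta> have Z: "Z = 2 * S * Y"
    unfolding Z_def Y_def \<Delta>_def E_def F_def by algebra
  \<comment> \<open>Squaring removes the last occurrence of \<open>S\<close>.\<close>
  have "Z\<^sup>2 = 4 * \<Delta> * Y\<^sup>2"
    unfolding Z \<Delta>[symmetric] by (simp add: power_mult_distrib)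
  then show ?thesis
    unfolding Let_def bm_def[symmetric] bp_def[symmetric] B_def[symmetric] Z_def \<Delta>_def Y_def N_def
    by (simp add: algebra_simps)
qed

end
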